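(* Let $\Delta>0$ be a constant such that $\Delta_1\le\Delta$, and let $k^*$ be the maximal index $k\in\{1,\dots,K\}$ such that $\Delta_k\le\Delta$. Suppose the critical values $\mathfrak z_1,\dots,\mathfrak z_{K-1}$ satisfy the propagation condition $$\mathbf{E}_0\bigl|v_k^{-1}(\widehat\theta_k-\widetilde\theta_k)^2\bigr|^r\le\alpha\,\mathfrak c_r,\qquad k=2,\dots,K.$$ Then $$\mathbf{E}\bigl|v_{k^*}^{-1}(\widetilde\theta_{k^*}-\widehat\theta)^2\bigr|^{r/2}\le\sqrt{\alpha\,\mathfrak c_r\,e^{\Delta}}+(2\mathfrak z_{k^*})^{r/2}.$$
   Context: Setting. Let $\widetilde\theta_k=\theta_k+\xi_k$, $k=1,\dots,K$, where $\theta_1,\dots,\theta_K$ are real numbers and $(\xi_1,\dots,\xi_K)$ is a zero-mean Gaussian vector with known invertible covariance matrix $B$. Put $v_k=\operatorname{Var}(\widetilde\theta_k)=\mathbf{E}\xi_k^2>0$; the $v_k$ decrease with $k$. $\mathbf{E}$ is expectation under this model. $\mathbf{E}_0$ is expectation when $\theta_1=\dots=\theta_K=0$ with the same covariance matrix $B$. Fix $r>0$, $\alpha>0$; $\mathfrak c_r=\mathbf{E}|\xi|^{2r}$ for $\xi$ standard normal. Procedure. Given critical values $\mathfrak z_1,\dots,\mathfrak z_{K-1}\in[0,\infty]$, let $T_{lk}=v_l^{-1}(\widetilde\theta_l-\widetilde\theta_k)^2/2$ for $l<k$, $$\widehat k=\max\{k\le K:\ T_{lm}\le\mathfrak z_l\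 \text{ for all } l<m\le k\},$$ $\widehat\theta=\widetilde\theta_{\widehat k}$ and $\widehat\theta_k=\widetilde\theta_{\min\{\widehat k,k\}}$. The value $\mathfrak z_K$, not used by the procedure, is an arbitrary nonnegative number. Modeling bias. Let $\theta\in\mathbb R$ be the target value, $b_k=\theta_k-\theta$, $b(k)=(b_1,\dots,b_k)^\top$, $B_k$ the covariance matrix of $(\widetilde\theta_1,\dots,\widetilde\theta_k)^\top$, and $\Delta_k=b(k)^\top B_k^{-1}b(k)$. *)

theory Defs
  imports "HOL-Probability.Probability" "Jordan_Normal_Form.Gauss_Jordan_Elimination"
begin

text \<open>
  A family of real random variables is a Gaussian vector if its joint law is that of an affine image
  of a vector of finitely many independent standard normal variables. Degenerate laws are allowed.
\<close>

definition gaussian_vector :: "'a measure \<Rightarrow> 'i set \<Rightarrow> ('i \<Rightarrow> 'a \<Rightarrow> real) \<Rightarrow> bool" where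
  "gaussian_vector M I X \<longleftrightarrow>
     finite I \<and> (\<forall>i\<in>I. X i \<in> borel_measurable M) \<and>
     (\<exists>(m::nat) (\<mu> :: 'i \<Rightarrow> real) (A :: 'i \<Rightarrow> nat \<Rightarrow> real).
        distr M (Pi\<^sub>M I (\<lambda>_. borel)) (\<lambda>\<omega>. \<lambda>i\<in>I. X i \<omega>) =
        distr (Pi\<^sub>M {..<m} (\<lambda>_. density lborel std_normal_density)) (Pi\<^sub>M I (\<lambda>_. borel))
          (\<lambda>x. \<lambda>i\<in>I. \<mu> i + (\<Sum>j<m. A i j * x j)))"

definition covariance :: "'a measure \<Rightarrow> ('a \<Rightarrow> real) \<Rightarrow> ('a \<Rightarrow> real) \<Rightarrow> real" where
  "covariance M X Y = (LINT \<omega>|M. (X \<omega> - (LINT \<omega>'|M. X \<omega>')) * (Y \<omega> - (LINT \<omega>'|M. Y \<omega>')))"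

text \<open>
  Matrices and vectors are indexed from 0, whereas random variables, parameters and critical values
  are indexed from 1; hence the shifts by \<open>Suc\<close> below.
\<close>

definition cov_mat :: "'a measure \<Rightarrow> nat \<Rightarrow> (nat \<Rightarrow> 'a \<Rightarrow> real) \<Rightarrow> real mat" where
  "cov_mat M k X = mat k k (\<lambda>(i, j). covariance M (X (Suc i)) (X (Suc j)))"

definition modeling_bias ::
    "'a measure \<Rightarrow> (nat \<Rightarrow> 'a \<Rightarrow> real) \<Rightarrow> (nat \<Rightarrow> real) \<Rightarrow> real \<Rightarrow> nat \<Rightarrow> real" where
  "modeling_bias M X \<theta> \<theta>0 k =
     (let b = vec k (\<lambda>i. \<theta> (Suc i) - \<theta>0)
      in scalar_prod b (mult_mat_vec (the (mat_inverse (cov_mat M k X))) b))"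

text \<open>
  The procedure as a function of the observed values \<open>y 1, \<dots>, y K\<close>. Critical values
  may be infinite, so the comparison with the test statistics is done in \<^typ>\<open>ennreal\<close>.
\<close>

definition test_stat :: "(nat \<Rightarrow> real) \<Rightarrow> (nat \<Rightarrow> real) \<Rightarrow> nat \<Rightarrow> nat \<Rightarrow> real" where
  "test_stat v y l k = inverse (v l) * (y l - y k)\<^sup>2 / 2"

definition khat :: "nat \<Rightarrow> (nat \<Rightarrow> real) \<Rightarrow> (nat \<Rightarrow> ennreal) \<Rightarrow> (nat \<Rightarrow> real) \<Rightarrow> nat" where
  "khat K v z y =
     Max {k \<in> {1..K}. \<forall>l m. 1 \<le> l \<and> l < m \<and> m \<le> k \<longrightarrow> ennreal (test_stat v y l m) \<le> z l}"

definition adaptive_est :: "nat \<Rightarrow> (nat \<Rightarrow> real) \<Rightarrow> (nat \<Rightarrow> ennreal) \<Rightarrow> (nat \<Rightarrow> real) \<Rightarrow> real" where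
  "adaptive_est K v z y = y (khat K v z y)"

definition adaptive_est_step ::
    "nat \<Rightarrow> (nat \<Rightarrow> real) \<Rightarrow> (nat \<Rightarrow> ennreal) \<Rightarrow> (nat \<Rightarrow> real) \<Rightarrow> nat \<Rightarrow> real" where
  "adaptive_est_step K v z y k = y (min (khat K v z y) k)"

definition normal_abs_moment :: "real \<Rightarrow> real" where
  "normal_abs_moment p = (LINT x|density lborel std_normal_density. \<bar>x\<bar> powr p)"

text \<open>Extension of the power function to infinite bases, for exponents \<open>a > 0\<close>.\<close>

definition ennreal_powr :: "ennreal \<Rightarrow> real \<Rightarrow> ennreal" where
  "ennreal_powr x a = (if x = \<infinity> then \<infinity> else ennreal (enn2real x powr a))"

end

theory Submission
  imports Defs "Jordan_Normal_Form.Determinant"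
begin

text \<open>
  On \<open>khat \<le> k*\<close> the adaptive estimate coincides with its version stopped at \<open>k*\<close>, and on
  \<open>khat > k*\<close> the acceptance rule bounds the loss by \<open>2 z\<close>. The loss of the stopped estimate only
  depends on the first \<open>k*\<close> observations and is invariant under a common translation, so only the
  bias \<open>b(k*)\<close> separates its law from that under \<open>E\<^sub>0\<close>. Write the noise as \<open>A x\<close> with \<open>x\<close> a vector of
  independent standard normals, so that the covariance matrix is \<open>A A\<^sup>T\<close>. The bias is then the image of
  the shift \<open>h = A\<^sup>T (A A\<^sup>T)\<^sup>-\<^sup>1 b\<close>, where \<open>A\<close> is restricted to the first \<open>k*\<close> rows, and the
  squared norm of \<open>h\<close> is the modeling bias. Shifting \<open>x\<close> by \<open>h\<close> has a density
  whose second moment is \<open>exp |h|\<^sup>2\<close>, and the Cauchy-Schwarz inequality concludes. This avoids the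
  density of the noise itself.
\<close>

subsection \<open>Gram matrices\<close>

text \<open>For standard normal \<open>x\<close> this is the covariance matrix of the first
  \<open>k\<close> coordinates of \<open>A x\<close>. Keeping \<open>k\<close> a parameter lets one
  \<open>A\<close> serve every leading block.\<close>

definition gram :: "nat \<Rightarrow> nat \<Rightarrow> (nat \<Rightarrow> nat \<Rightarrow> real) \<Rightarrow> real mat" where
  "gram m k A = mat k k (\<lambda>(i, j). \<Sum>l<m. A i l * A j l)"

lemma gram_carrier [simp]: "gram m k A \<in> carrier_mat k k"
  by (simp add: gram_def)

lemma gram_dim [simp]: "dim_row (gram m k A) = k" "dim_col (gram m k A) = k"
  by (simp_all add: gram_def)

lemma gram_mult_vec:
  assumes "v \<in> carrier_vec k" "i < k"
  shows "vec_index (gram m k A *\<^sub>v v) i = (\<Sum>l<m. A i l * (\<Sum>j<k. A j l * vec_index v j))"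
proof -
  have "vec_index (gram m k A *\<^sub>v v) i = (\<Sum>j<k. (\<Sum>l<m. A i l * A j l) * vec_index v j)"
    using assms by (simp add: gram_def scalar_prod_def atLeast0LessThan)
  also have "\<dots> = (\<Sum>j<k. \<Sum>l<m. A i l * (A j l * vec_index v j))"
    by (simp add: sum_distrib_right mult.assoc)
  also have "\<dots> = (\<Sum>l<m. \<Sum>j<k. A i l * (A j l * vec_index v j))"
    by (rule sum.swap)
  finally show ?thesis by (simp add: sum_distrib_left)
qed

text \<open>The form equals \<open>|A^T v|^2\<close>. Its vanishing detects kernel vectors, and its
  value gives the norm of the shift \<open>A^T v\<close>.\<close>

lemma gram_quadratic_form:
  assumes "v \<in> carrier_vec k"
  shows "scalar_prod v (gram m k A *\<^sub>v v) = (\<Sum>l<m. (\<Sum>j<k. A j l * vec_index v j)\<^sup>2)"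
proof -
  let ?s = "\<lambda>l. \<Sum>j<k. A j l * vec_index v j"
  have "scalar_prod v (gram m k A *\<^sub>v v) = (\<Sum>i<k. vec_index v i * (\<Sum>l<m. A i l * ?s l))"
    by (simp add: scalar_prod_def[of v] atLeast0LessThan gram_mult_vec[OF assms]
        del: index_mult_mat_vec)
  also have "\<dots> = (\<Sum>i<k. \<Sum>l<m. (A i l * vec_index v i) * ?s l)"
    by (simp add: sum_distrib_left mult_ac)
  also have "\<dots> = (\<Sum>l<m. \<Sum>i<k. (A i l * vec_index v i) * ?s l)"
    by (rule sum.swap)
  also have "\<dots> = (\<Sum>l<m. ?s l * ?s l)"
    by (simp add: sum_distrib_right)
  finally show ?thesis by (simp add: power2_eq_square)
qed

lemma invertible_mat_kernel:
  assumes A: "(A :: real mat) \<in> carrier_mat n n" and "invertible_mat A"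
    and w: "w \<in> carrier_vec n" and "A *\<^sub>v w = 0\<^sub>v n"
  shows "w = 0\<^sub>v n"
proof -
  obtain C where AC: "A * C = 1\<^sub>m (dim_row A)" and CA: "C * A = 1\<^sub>m (dim_row C)"
    using assms(2) by (auto simp: invertible_mat_def inverts_mat_def)
  \<comment> \<open>\<open>invertible_mat\<close> leaves the dimensions of \<open>C\<close> open;
    comparing column counts in the two identities fixes them.\<close>
  have "dim_row C = n" using arg_cong[OF CA, of dim_col] A by simp
  moreover have "dim_col C = n" using arg_cong[OF AC, of dim_col] A by simp
  ultimately have C: "C \<in> carrier_mat n n" by auto
  have "w = (C * A) *\<^sub>v w" using w CA C by simp
  also have "\<dots> = C *\<^sub>v (A *\<^sub>v w)" using C A w by (simp add: assoc_mult_mat_vec)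
  also have "\<dots> = 0\<^sub>v n" using C assms(4) by auto
  finally show ?thesis .
qed

text \<open>A kernel vector of the smaller matrix, padded with zeros, is a kernel vector of the larger
  one: both kernels consist of the coefficients of vanishing combinations of the rows of \<open>A\<close>.\<close>

lemma det_gram_nonzero:
  assumes inv: "invertible_mat (gram m n A)" and "k \<le> n"
  shows "det (gram m k A) \<noteq> 0"
proof
  assume "det (gram m k A) = 0"
  then obtain v where v: "v \<in> carrier_vec k" "v \<noteq> 0\<^sub>v k" "gram m k A *\<^sub>v v = 0\<^sub>v k"
    using det_0_iff_vec_prod_zero_field[OF gram_carrier] by blast
  have "(\<Sum>l<m. (\<Sum>j<k. A j l * vec_index v j)\<^sup>2) = 0"
    using gram_quadratic_form[OF v(1), of m A] v by simp
  then have s0: "(\<Sum>j<k. A j l * vec_index v j) = 0" if "l < m" for l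
    using that by (subst (asm) sum_nonneg_eq_0_iff) auto
  define w where "w = vec n (\<lambda>j. if j < k then vec_index v j else 0)"
  have w: "w \<in> carrier_vec n" by (simp add: w_def)
  have "(\<Sum>j<n. A j l * vec_index w j) = (\<Sum>j<k. A j l * vec_index v j)" for l
    using \<open>k \<le> n\<close> by (intro sum.mono_neutral_cong_right) (auto simp: w_def)
  then have "gram m n A *\<^sub>v w = 0\<^sub>v n"
    using s0 by (intro eq_vecI) (auto simp: gram_mult_vec[OF w] simp del: index_mult_mat_vec)
  then have "w = 0\<^sub>v n" using invertible_mat_kernel[OF gram_carrier inv w] by simp
  have "vec_index v j = 0" if "j < k" for j
  proof -
    have "vec_index w j = 0" using \<open>w = 0\<^sub>v n\<close> that \<open>k \<le> n\<close> by simp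
    then show ?thesis using that \<open>k \<le> n\<close> by (simp add: w_def)
  qed
  then have "v = 0\<^sub>v k" using v(1) by (intro eq_vecI) auto
  with v show False by simp
qed

text \<open>For \<open>G = A A^T\<close>, put \<open>v = G^-1 b\<close> and
  \<open>h = A^T v\<close>. Then \<open>A h = G v = b\<close>, while
  \<open>|h|^2 = v . G v = v . b\<close>.\<close>

lemma gram_preimage:
  assumes "invertible_mat (gram m n A)" and "k \<le> n"
  obtains h where "\<And>i. i < k \<Longrightarrow> (\<Sum>l<m. A i l * h l) = b i"
    and "(\<Sum>l<m. (h l)\<^sup>2) =
           scalar_prod (vec k b) (the (mat_inverse (gram m k A)) *\<^sub>v vec k b)"
proof -
  let ?G = "gram m k A"
  \<comment> \<open>\<open>modeling_bias\<close> applies \<open>the\<close>, so the computed inverse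
    has to exist. The instantiation with \<open>()\<close> makes both facts speak of the same matrix
    ring.\<close>
  have "mat_inverse ?G \<noteq> None"
    using det_non_zero_imp_unit[OF gram_carrier det_gram_nonzero[OF assms], where b = "()"]
      mat_inverse(1)[OF gram_carrier, where b = "()"] by metis
  then obtain C where Some: "mat_inverse ?G = Some C" by auto
  then have C: "?G * C = 1\<^sub>m k" "C \<in> carrier_mat k k"
    using mat_inverse(2)[OF gram_carrier] by blast+
  define v where "v = C *\<^sub>v vec k b"
  have v: "v \<in> carrier_vec k" using C by (simp add: v_def)
  have Gv: "?G *\<^sub>v v = vec k b"
    using C by (simp add: v_def assoc_mult_mat_vec[symmetric, OF gram_carrier C(2)])
  let ?h = "\<lambda>l. \<Sum>j<k. A j l * vec_index v j"
  have "(\<Sum>l<m. A i l * ?h l) = b i" if "i < k" for i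
    using gram_mult_vec[OF v that, of m A] that by (simp add: Gv)
  moreover have "(\<Sum>l<m. (?h l)\<^sup>2) = scalar_prod (vec k b) v"
    using gram_quadratic_form[OF v, of m A] v by (simp add: Gv comm_scalar_prod)
  ultimately show thesis using that[of ?h] by (simp add: Some v_def[symmetric])
qed

subsection \<open>Shifts of standard normal vectors\<close>

text \<open>Translating the Lebesgue integral moves the shift into the density, and the exponential
  is the quotient of the shifted by the unshifted density.\<close>

lemma nn_integral_std_normal_shift:
  assumes [measurable]: "f \<in> borel_measurable borel"
  shows "(\<integral>\<^sup>+x. f (x + h) \<partial>std_normal_distribution) =
         (\<integral>\<^sup>+x. f x * ennreal (exp (h * x - h\<^sup>2 / 2)) \<partial>std_normal_distribution)"
proof -
  have dens: "std_normal_density (x - h) = std_normal_density x * exp (h * x - h\<^sup>2 / 2)" for x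
    by (simp add: std_normal_density_def exp_add[symmetric] power2_eq_square field_simps)
  have "(\<integral>\<^sup>+x. f (x + h) \<partial>std_normal_distribution) =
        (\<integral>\<^sup>+x. ennreal (std_normal_density x) * f (x + h) \<partial>lborel)"
    by (simp add: nn_integral_density)
  also have "\<dots> = (\<integral>\<^sup>+x. ennreal (std_normal_density (x - h)) * f x \<partial>lborel)"
    by (subst (2) nn_integral_real_affine[where c = 1 and t = h]) (simp_all add: add.commute)
  also have "\<dots> = (\<integral>\<^sup>+x. ennreal (std_normal_density x) * (f x * ennreal (exp (h * x - h\<^sup>2 / 2))) \<partial>lborel)"
    by (simp add: dens ennreal_mult mult_ac)
  also have "\<dots> = (\<integral>\<^sup>+x. f x * ennreal (exp (h * x - h\<^sup>2 / 2)) \<partial>std_normal_distribution)"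
    by (simp add: nn_integral_density)
  finally show ?thesis .
qed

lemma product_sigma_finite_std_normal:
  "product_sigma_finite (\<lambda>_. std_normal_distribution)"
  by (intro product_sigma_finite.intro prob_space_imp_sigma_finite prob_space_normal_density) simp

lemma sets_PiM_std_normal [measurable_cong]:
  "sets (Pi\<^sub>M I (\<lambda>_. std_normal_distribution)) = sets (Pi\<^sub>M I (\<lambda>_. borel))"
  by (intro sets_PiM_cong) auto

lemma prob_space_PiM_std_normal: "prob_space (Pi\<^sub>M I (\<lambda>_. std_normal_distribution))"
  by (intro prob_space_PiM prob_space_normal_density) simp

text \<open>Cameron-Martin formula in finite dimension, by Fubini: the inner integral over the new
  coordinate uses the one-dimensional formula, the outer one the induction hypothesis.
  \<open>f\<close> stays arbitrary because that hypothesis is applied to the inner integral.\<close>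

lemma nn_integral_PiM_std_normal_shift:
  assumes "finite I" and "f \<in> borel_measurable (Pi\<^sub>M I (\<lambda>_. borel))"
  shows "(\<integral>\<^sup>+x. f (\<lambda>i\<in>I. x i + h i) \<partial>Pi\<^sub>M I (\<lambda>_. std_normal_distribution)) =
         (\<integral>\<^sup>+x. f x * ennreal (exp (\<Sum>i\<in>I. h i * x i - (h i)\<^sup>2 / 2))
            \<partial>Pi\<^sub>M I (\<lambda>_. std_normal_distribution))"
  using assms
proof (induction I arbitrary: f rule: finite_induct)
  case empty
  interpret product_sigma_finite "\<lambda>_. std_normal_distribution"
    by (rule product_sigma_finite_std_normal)
  show ?case
    using prob_space.emeasure_space_1[OF prob_space_PiM_std_normal, of "{} :: 'a set"]
    by (simp add: nn_integral_empty restrict_def)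
next
  case (insert i I)
  interpret product_sigma_finite "\<lambda>_::'a. std_normal_distribution"
    by (rule product_sigma_finite_std_normal)
  note [measurable] = insert.prems
  have sf: "sigma_finite_measure std_normal_distribution"
    by (intro prob_space_imp_sigma_finite prob_space_normal_density) simp
  let ?N = std_normal_distribution
  let ?P = "Pi\<^sub>M I (\<lambda>_. ?N)"
  let ?e = "\<lambda>x. ennreal (exp (\<Sum>j\<in>I. h j * x j - (h j)\<^sup>2 / 2))"
  let ?d = "\<lambda>y. ennreal (exp (h i * y - (h i)\<^sup>2 / 2))"
  have upd: "(\<lambda>j\<in>insert i I. (x(i := y)) j + h j) = (\<lambda>j\<in>I. x j + h j)(i := y + h i)" for x y
    using insert.hyps by (auto simp: restrict_def)
  \<comment> \<open>\<open>g\<close> already carries the weight for coordinate \<open>i\<close>, so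
    only the coordinates in \<open>I\<close> remain shifted.\<close>
  define g where "g = (\<lambda>x. \<integral>\<^sup>+y. f (x(i := y)) * ?d y \<partial>?N)"
  interpret N: sigma_finite_measure ?N by (rule sf)
  have g [measurable]: "g \<in> borel_measurable (Pi\<^sub>M I (\<lambda>_. borel))"
    unfolding g_def by measurable
  have "(\<integral>\<^sup>+x. f (\<lambda>j\<in>insert i I. x j + h j) \<partial>Pi\<^sub>M (insert i I) (\<lambda>_. ?N)) =
        (\<integral>\<^sup>+x. \<integral>\<^sup>+y. f ((\<lambda>j\<in>I. x j + h j)(i := y + h i)) \<partial>?N \<partial>?P)"
    using insert.hyps by (subst product_nn_integral_insert) (simp_all only: upd, measurable)
  also have "\<dots> = (\<integral>\<^sup>+x. g (\<lambda>j\<in>I. x j + h j) \<partial>?P)"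
    unfolding g_def
  proof (rule nn_integral_cong)
    fix x
    \<comment> \<open>Restriction to \<open>I\<close> is extensional, so the section is measurable
      even for \<open>x\<close> outside the product space.\<close>
    have "(\<lambda>y. f ((\<lambda>j\<in>I. x j + h j)(i := y))) \<in> borel_measurable borel"
      by (rule measurable_compose[OF measurable_fun_upd[where I="insert i I" and J=I] insert.prems])
         (auto simp: space_PiM)
    then show "(\<integral>\<^sup>+y. f ((\<lambda>j\<in>I. x j + h j)(i := y + h i)) \<partial>?N) =
          (\<integral>\<^sup>+y. f ((\<lambda>j\<in>I. x j + h j)(i := y)) * ?d y \<partial>?N)"
      by (rule nn_integral_std_normal_shift)
  qed
  also have "\<dots> = (\<integral>\<^sup>+x. g x * ?e x \<partial>?P)"
    by (rule insert.IH[OF g])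
  also have "\<dots> = (\<integral>\<^sup>+x. \<integral>\<^sup>+y. f (x(i := y)) * ?d y * ?e x \<partial>?N \<partial>?P)"
  proof (rule nn_integral_cong)
    fix x assume [measurable]: "x \<in> space ?P"
    have "(\<lambda>y. f (x(i := y)) * ?d y) \<in> borel_measurable ?N"
      by measurable (use \<open>x \<in> space ?P\<close> in \<open>auto simp: space_PiM PiE_def extensional_def\<close>)
    then show "g x * ?e x = (\<integral>\<^sup>+y. f (x(i := y)) * ?d y * ?e x \<partial>?N)"
      unfolding g_def by (simp add: nn_integral_multc)
  qed
  also have "\<dots> = (\<integral>\<^sup>+x. \<integral>\<^sup>+y. (\<lambda>x. f x * ennreal (exp (\<Sum>j\<in>insert i I. h j * x j - (h j)\<^sup>2 / 2))) (x(i := y)) \<partial>?N \<partial>?P)"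
  proof (intro nn_integral_cong)
    fix x y
    have "(\<Sum>j\<in>I. h j * (x(i := y)) j - (h j)\<^sup>2 / 2) = (\<Sum>j\<in>I. h j * x j - (h j)\<^sup>2 / 2)"
      using insert.hyps by (intro sum.cong) auto
    then show "f (x(i := y)) * ?d y * ?e x =
      (\<lambda>x. f x * ennreal (exp (\<Sum>j\<in>insert i I. h j * x j - (h j)\<^sup>2 / 2))) (x(i := y))"
      using insert.hyps by (simp add: exp_add ennreal_mult mult.assoc)
  qed
  also have "\<dots> = (\<integral>\<^sup>+x. f x * ennreal (exp (\<Sum>j\<in>insert i I. h j * x j - (h j)\<^sup>2 / 2)) \<partial>Pi\<^sub>M (insert i I) (\<lambda>_. ?N))"
    using insert.hyps by (subst product_nn_integral_insert) auto
  finally show ?case .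
qed

text \<open>Cauchy-Schwarz is applied to \<open>f\<close> times the density of the shift, whose
  second moment is \<open>exp |h|^2\<close>.\<close>

lemma nn_integral_PiM_std_normal_shift_le:
  assumes I: "finite I" and f [measurable]: "f \<in> borel_measurable (Pi\<^sub>M I (\<lambda>_. borel))"
  shows "(\<integral>\<^sup>+x. f (\<lambda>i\<in>I. x i + h i) \<partial>Pi\<^sub>M I (\<lambda>_. std_normal_distribution))\<^sup>2 \<le>
         (\<integral>\<^sup>+x. (f x)\<^sup>2 \<partial>Pi\<^sub>M I (\<lambda>_. std_normal_distribution)) * ennreal (exp (\<Sum>i\<in>I. (h i)\<^sup>2))"
proof -
  let ?P = "Pi\<^sub>M I (\<lambda>_. std_normal_distribution)"
  let ?Z = "\<lambda>h x. ennreal (exp (\<Sum>i\<in>I. h i * x i - (h i)\<^sup>2 / 2))"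
  interpret prob_space ?P by (rule prob_space_PiM_std_normal)
  \<comment> \<open>Squaring doubles the shift up to a constant:
    \<open>2 (h x - h^2 / 2) = (2 h) x - (2 h)^2 / 2 + h^2\<close>. The factor 1 is the constant
    integrand with which the shift formula shows that the density for \<open>2 h\<close> has
    integral 1.\<close>
  have Z: "(?Z h x)\<^sup>2 = 1 * ?Z (\<lambda>i. 2 * h i) x * ennreal (exp (\<Sum>i\<in>I. (h i)\<^sup>2))" for x
    by (simp add: power2_eq_square ennreal_mult[symmetric] exp_add[symmetric] sum.distrib[symmetric]
        algebra_simps)
  have "(\<integral>\<^sup>+x. 1 * ?Z (\<lambda>i. 2 * h i) x \<partial>?P) = (\<integral>\<^sup>+x. 1 \<partial>?P)"
    by (rule nn_integral_PiM_std_normal_shift[OF I, symmetric]) simp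
  then have Z2: "(\<integral>\<^sup>+x. (?Z h x)\<^sup>2 \<partial>?P) = ennreal (exp (\<Sum>i\<in>I. (h i)\<^sup>2))"
    unfolding Z by (subst nn_integral_multc) (simp_all add: emeasure_space_1)
  have "(\<integral>\<^sup>+x. f (\<lambda>i\<in>I. x i + h i) \<partial>?P)\<^sup>2 = (\<integral>\<^sup>+x. f x * ?Z h x \<partial>?P)\<^sup>2"
    by (simp add: nn_integral_PiM_std_normal_shift[OF assms])
  also have "\<dots> \<le> (\<integral>\<^sup>+x. (f x)\<^sup>2 \<partial>?P) * (\<integral>\<^sup>+x. (?Z h x)\<^sup>2 \<partial>?P)"
    by (rule Cauchy_Schwarz_nn_integral) measurable
  finally show ?thesis by (simp only: Z2)
qed

subsection \<open>Centered Gaussian vectors\<close>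

lemma std_normal_mean_variance:
  "integrable std_normal_distribution (\<lambda>x. x)"
  "(LINT x|std_normal_distribution. x) = 0"
  "integrable std_normal_distribution (\<lambda>x. x\<^sup>2)"
  "(LINT x|std_normal_distribution. x\<^sup>2) = 1"
  using integrable_std_normal_distribution_moment[of 1] integral_std_normal_distribution_moment_odd[of 1]
    std_normal_distribution_even_moments[of 1]
  by simp_all

lemma PiM_std_normal_moments:
  assumes "finite I" "i \<in> I" "j \<in> I"
  defines "P \<equiv> Pi\<^sub>M I (\<lambda>_. std_normal_distribution)"
  shows "integrable P (\<lambda>x. x i)" "(LINT x|P. x i) = 0"
    "integrable P (\<lambda>x. x i * x j)" "(LINT x|P. x i * x j) = (if i = j then 1 else 0)"
proof -
  interpret product_sigma_finite "\<lambda>_::'a. std_normal_distribution"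
    by (rule product_sigma_finite_std_normal)
  interpret N: prob_space std_normal_distribution by (rule prob_space_normal_density) simp
  have comp: "distr P std_normal_distribution (\<lambda>x. x i) = std_normal_distribution"
    unfolding P_def using assms by (intro distr_PiM_component N.prob_space_axioms)
  have meas: "(\<lambda>x. x i) \<in> P \<rightarrow>\<^sub>M std_normal_distribution"
    unfolding P_def using assms by measurable
  have id: "(\<lambda>x. x) \<in> borel_measurable std_normal_distribution" by simp
  show "integrable P (\<lambda>x. x i)"
    using std_normal_mean_variance(1) integrable_distr_eq[OF meas id] unfolding comp by blast
  show "(LINT x|P. x i) = 0"
    using std_normal_mean_variance(2) integral_distr[OF meas id] unfolding comp by argo
  \<comment> \<open>The monomial \<open>x i * x j\<close> is written as a product over all
    coordinates, so independence reduces its integral to one-dimensional ones. A factor is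
    \<open>x * x\<close> if \<open>l = i = j\<close>, \<open>x\<close> if \<open>l\<close> equals
    just one of them, and 1 otherwise.\<close>
  let ?f = "\<lambda>l x. (if l = i then x else 1) * (if l = j then x else 1) :: real"
  have prod: "(\<Prod>l\<in>I. ?f l (x l)) = x i * x j" for x
    unfolding prod.distrib using assms by (simp add: prod.delta)
  have f: "integrable std_normal_distribution (?f l)" for l
    using std_normal_mean_variance[unfolded power2_eq_square]
    by (cases "l = i"; cases "l = j") simp_all
  have E: "(LINT x|std_normal_distribution. ?f l x) = (if (l = i) = (l = j) then 1 else 0)" for l
    using std_normal_mean_variance[unfolded power2_eq_square] N.prob_space
    by (cases "l = i"; cases "l = j") simp_all
  show "integrable P (\<lambda>x. x i * x j)"
    using product_integrable_prod[OF assms(1), of ?f] f by (simp add: prod P_def)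
  have "(LINT x|P. x i * x j) = (\<Prod>l\<in>I. if (l = i) = (l = j) then 1 else 0)"
    using product_integral_prod[OF assms(1), of ?f] f by (simp add: prod E P_def)
  also have "\<dots> = (if i = j then 1 else 0)"
    using assms by (auto simp: prod_zero_iff)
  finally show "(LINT x|P. x i * x j) = (if i = j then 1 else 0)" .
qed

text \<open>Zero mean removes the translation in the affine representation, leaving a linear image
  of a standard normal vector. The law is stated for restricted families, as these are the points of
  the product space.\<close>

lemma gaussian_vector_zero_meanE:
  fixes I :: "'i set" and X :: "'i \<Rightarrow> 'a \<Rightarrow> real"
  assumes gaussian: "gaussian_vector M I X"
    and mean: "\<And>i. i \<in> I \<Longrightarrow> (LINT \<omega>|M. X i \<omega>) = 0"
  obtains m :: nat and A where
    "\<And>f. f \<in> borel_measurable (Pi\<^sub>M I (\<lambda>_. borel)) \<Longrightarrow>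
      (\<integral>\<^sup>+\<omega>. f (\<lambda>i\<in>I. X i \<omega>) \<partial>M) =
      (\<integral>\<^sup>+x. f (\<lambda>i\<in>I. \<Sum>j<m. A i j * x j) \<partial>Pi\<^sub>M {..<m} (\<lambda>_. std_normal_distribution))"
    and "\<And>i. i \<in> I \<Longrightarrow> integrable M (X i)"
    and "\<And>i k. i \<in> I \<Longrightarrow> k \<in> I \<Longrightarrow> covariance M (X i) (X k) = (\<Sum>j<m. A i j * A k j)"
proof -
  let ?B = "Pi\<^sub>M I (\<lambda>_. borel) :: ('i \<Rightarrow> real) measure"
  let ?N = "std_normal_distribution"
  have X: "\<And>i. i \<in> I \<Longrightarrow> X i \<in> borel_measurable M"
    using gaussian by (simp add: gaussian_vector_def)
  obtain m :: nat and \<mu> A where D: "distr M ?B (\<lambda>\<omega>. \<lambda>i\<in>I. X i \<omega>) =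
      distr (Pi\<^sub>M {..<m} (\<lambda>_. ?N)) ?B (\<lambda>x. \<lambda>i\<in>I. \<mu> i + (\<Sum>j<m. A i j * x j))"
    using gaussian unfolding gaussian_vector_def by blast
  let ?P = "Pi\<^sub>M {..<m} (\<lambda>_. ?N)"
  let ?Y = "\<lambda>i x. \<mu> i + (\<Sum>j<m. A i j * x j)"
  interpret P: prob_space ?P by (rule prob_space_PiM_std_normal)
  have mX: "(\<lambda>\<omega>. \<lambda>i\<in>I. X i \<omega>) \<in> M \<rightarrow>\<^sub>M ?B"
    using X by (intro measurable_restrict)
  have mY: "(\<lambda>x. \<lambda>i\<in>I. ?Y i x) \<in> ?P \<rightarrow>\<^sub>M ?B"
    by measurable
  have nn: "(\<integral>\<^sup>+\<omega>. f (\<lambda>i\<in>I. X i \<omega>) \<partial>M) = (\<integral>\<^sup>+x. f (\<lambda>i\<in>I. ?Y i x) \<partial>?P)"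
    if "f \<in> borel_measurable ?B" for f
    using nn_integral_distr[OF mX, of f] nn_integral_distr[OF mY, of f] that D by simp
  have int: "integrable M (\<lambda>\<omega>. f (\<lambda>i\<in>I. X i \<omega>)) \<longleftrightarrow> integrable ?P (\<lambda>x. f (\<lambda>i\<in>I. ?Y i x))"
    "(LINT \<omega>|M. f (\<lambda>i\<in>I. X i \<omega>)) = (LINT x|?P. f (\<lambda>i\<in>I. ?Y i x))"
    if "f \<in> borel_measurable ?B" for f :: "_ \<Rightarrow> real"
    using integrable_distr_eq[OF mX that] integrable_distr_eq[OF mY that]
      integral_distr[OF mX that] integral_distr[OF mY that] D by simp_all
  note mom = PiM_std_normal_moments[OF finite_lessThan[of m], unfolded lessThan_iff]
  have iY: "integrable ?P (?Y i)" for i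
    using mom by (intro Bochner_Integration.integrable_add Bochner_Integration.integrable_sum) auto
  \<comment> \<open>Integrability comes from the representation: a zero Bochner integral alone would
    not give it, since non-integrable functions also have integral 0.\<close>
  have iX: "integrable M (X i)" if "i \<in> I" for i
    using int(1)[OF measurable_component_singleton[OF that]] iY that by simp
  have \<mu>: "\<mu> i = 0" if "i \<in> I" for i
  proof -
    have "0 = (LINT x|?P. ?Y i x)"
      using int(2)[OF measurable_component_singleton[OF that]] mean[OF that] that by simp
    also have "\<dots> = \<mu> i"
      using mom P.prob_space by (subst Bochner_Integration.integral_add) auto
    finally show ?thesis by simp
  qed
  have "covariance M (X i) (X k) = (\<Sum>j<m. A i j * A k j)" if "i \<in> I" "k \<in> I" for i k
  proof -
    have "covariance M (X i) (X k) = (LINT \<omega>|M. X i \<omega> * X k \<omega>)"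
      using that mean by (simp add: covariance_def)
    also have "\<dots> = (LINT x|?P. ?Y i x * ?Y k x)"
      using int(2)[of "\<lambda>y. y i * y k"] that by simp
    also have "\<dots> = (LINT x|?P. (\<Sum>j<m. \<Sum>l<m. A i j * A k l * (x j * x l)))"
      using that by (simp add: \<mu> sum_product mult_ac)
    also have "\<dots> = (\<Sum>j<m. \<Sum>l<m. A i j * A k l * (if j = l then 1 else 0))"
      using mom(3,4)
      by (intro has_bochner_integral_integral_eq has_bochner_integral_sum has_bochner_integral_mult_right)
        (simp add: has_bochner_integral_iff)
    also have "\<dots> = (\<Sum>j<m. A i j * A k j)"
      by (simp add: if_distrib cong: if_cong)
    finally show ?thesis .
  qed
  moreover have "(\<integral>\<^sup>+\<omega>. f (\<lambda>i\<in>I. X i \<omega>) \<partial>M) = (\<integral>\<^sup>+x. f (\<lambda>i\<in>I. \<Sum>j<m. A i j * x j) \<partial>?P)"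
    if "f \<in> borel_measurable ?B" for f
    using nn[OF that] by (simp add: \<mu> cong: restrict_cong)
  ultimately show thesis using that iX by blast
qed

subsection \<open>The adaptive procedure\<close>

lemma khat_Max:
  fixes K v z y
  defines "S \<equiv> {k \<in> {1..K}. \<forall>l m. 1 \<le> l \<and> l < m \<and> m \<le> k \<longrightarrow> ennreal (test_stat v y l m) \<le> z l}"
  assumes "1 \<le> K"
  shows "khat K v z y \<in> S" and "j \<in> S \<Longrightarrow> j \<le> khat K v z y"
proof -
  have fin: "finite S" by (simp add: S_def)
  \<comment> \<open>For \<open>k = 1\<close> there is no pair \<open>l < m\<close> to test, hence
    the maximum is over a nonempty set.\<close>
  moreover have "1 \<in> S" using \<open>1 \<le> K\<close> by (auto simp: S_def)
  ultimately have "Max S \<in> S" by (intro Max_in) auto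
  then show "khat K v z y \<in> S" by (simp only: khat_def S_def)
  show "j \<in> S \<Longrightarrow> j \<le> khat K v z y"
    using Max_ge[OF fin] by (simp only: khat_def S_def)
qed

lemma khat_in_range: "1 \<le> K \<Longrightarrow> khat K v z y \<in> {1..K}"
  using khat_Max(1) by blast

text \<open>Acceptance of an index entails acceptance of every smaller one, so reaching
  \<open>j\<close> is decided by the tests up to \<open>j\<close> alone.\<close>

lemma le_khat_iff:
  assumes "j \<in> {1..K}"
  shows "j \<le> khat K v z y \<longleftrightarrow>
    (\<forall>l m. 1 \<le> l \<and> l < m \<and> m \<le> j \<longrightarrow> ennreal (test_stat v y l m) \<le> z l)"
    (is "_ \<longleftrightarrow> ?Q j")
proof
  have K: "1 \<le> K" using assms by simp
  assume "j \<le> khat K v z y"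
  moreover have "?Q (khat K v z y)" using khat_Max(1)[OF K, of v z y] by blast
  ultimately show "?Q j" by (meson order_trans)
next
  have K: "1 \<le> K" using assms by simp
  assume "?Q j"
  with assms show "j \<le> khat K v z y" by (intro khat_Max(2)[OF K]) blast
qed

text \<open>A minimum with \<open>k\<close> is determined by the indices \<open>j <= k\<close> below
  it. By \<open>le_khat_iff\<close> these depend on the first \<open>k\<close> observations, and the
  test statistics see only their differences.\<close>

lemma khat_step_cong:
  assumes k: "k \<in> {1..K}" and y: "\<And>i. i \<in> {1..k} \<Longrightarrow> y i = c + y' i"
  shows "min (khat K v z y) k = min (khat K v z y') k"
proof -
  have stat: "test_stat v y l m = test_stat v y' l m" if "1 \<le> l" "l < m" "m \<le> k" for l m
    using that y[of l] y[of m] by (simp add: test_stat_def)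
  have iff: "j \<le> khat K v z y \<longleftrightarrow> j \<le> khat K v z y'" if j: "j \<in> {1..k}" for j
  proof -
    have "j \<in> {1..K}" using j k by auto
    moreover have "(1 \<le> l \<and> l < n \<and> n \<le> j \<longrightarrow> ennreal (test_stat v y l n) \<le> z l) \<longleftrightarrow>
        (1 \<le> l \<and> l < n \<and> n \<le> j \<longrightarrow> ennreal (test_stat v y' l n) \<le> z l)" for l n
      using stat[of l n] j by auto
    ultimately show ?thesis by (simp only: le_khat_iff)
  qed
  have "1 \<le> K" using k by simp
  then have "1 \<le> khat K v z y" "1 \<le> khat K v z y'"
    using khat_in_range[of K v z] by (meson atLeastAtMost_iff)+
  then show ?thesis
    using iff[of "min (khat K v z y) k"] iff[of "min (khat K v z y') k"] k by auto
qed

lemma adaptive_est_step_shift: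
  assumes k: "k \<in> {1..K}" and y: "\<And>i. i \<in> {1..k} \<Longrightarrow> y i = c + y' i"
  shows "adaptive_est_step K v z y k = c + adaptive_est_step K v z y' k"
proof -
  have "1 \<le> khat K v z y'" using khat_in_range[of K v z y'] k by simp
  then show ?thesis
    using k y[of "min (khat K v z y') k"] khat_step_cong[OF k y, where z = z and v = v]
    by (simp add: adaptive_est_step_def)
qed

lemma measurable_adaptive_est_step:
  assumes k: "k \<in> {1..K}" and Y: "\<And>i. i \<in> {1..K} \<Longrightarrow> Y i \<in> borel_measurable S"
  shows "(\<lambda>\<omega>. adaptive_est_step K v z (\<lambda>i. Y i \<omega>) k) \<in> borel_measurable S"
proof -
  \<comment> \<open>Measurability of \<open>khat\<close> is derived with all coordinates measurable,
    so those outside \<open>{1..K}\<close> are set to 0; the stopped estimate does not see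
    them.\<close>
  define Y' where "Y' = (\<lambda>i \<omega>. if i \<in> {1..K} then Y i \<omega> else 0)"
  have [measurable]: "Y' i \<in> borel_measurable S" for i
    using Y[of i] unfolding Y'_def by (cases "i \<in> {1..K}") (simp_all only: if_True if_False, simp)
  have [measurable]: "(\<lambda>\<omega>. khat K v z (\<lambda>i. Y' i \<omega>)) \<in> S \<rightarrow>\<^sub>M count_space UNIV"
    unfolding khat_def test_stat_def by measurable
  \<comment> \<open>An observation picked at a random index is measurable because the index takes
    countably many values.\<close>
  have "(\<lambda>\<omega>. Y' (min (khat K v z (\<lambda>i. Y' i \<omega>)) k) \<omega>) \<in> borel_measurable S"
    by (rule measurable_compose_countable) measurable
  moreover have "adaptive_est_step K v z (\<lambda>i. Y i \<omega>) k = Y' (min (khat K v z (\<lambda>i. Y' i \<omega>)) k) \<omega>" for \<omega>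
    using adaptive_est_step_shift[OF k, of "\<lambda>i. Y i \<omega>" 0 "\<lambda>i. Y' i \<omega>"] k
    by (simp add: Y'_def adaptive_est_step_def)
  ultimately show ?thesis by simp
qed

text \<open>With \<open>p = r\<close> and the noise as data this is the integrand of the propagation
  condition; with \<open>p = r / 2\<close> it is the stopped part of the loss to be bounded.\<close>

definition step_loss :: "nat \<Rightarrow> (nat \<Rightarrow> real) \<Rightarrow> (nat \<Rightarrow> ennreal) \<Rightarrow> real \<Rightarrow> nat \<Rightarrow> (nat \<Rightarrow> real) \<Rightarrow> real" where
  "step_loss K v z p k y = \<bar>inverse (v k) * (adaptive_est_step K v z y k - y k)\<^sup>2\<bar> powr p"

lemma step_loss_nonneg: "0 \<le> step_loss K v z p k y"
  by (simp add: step_loss_def)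

text \<open>Taking \<open>c = 0\<close> changes observations beyond \<open>k\<close> at will; taking
  \<open>c = \<theta>0\<close> subtracts the target and leaves the bias.\<close>

lemma step_loss_shift:
  assumes "k \<in> {1..K}" and "\<And>i. i \<in> {1..k} \<Longrightarrow> y i = c + y' i"
  shows "step_loss K v z p k y = step_loss K v z p k y'"
  using adaptive_est_step_shift[OF assms] assms by (simp add: step_loss_def)

lemma step_loss_half_squared: "(step_loss K v z (p / 2) k y)\<^sup>2 = step_loss K v z p k y"
  by (simp add: step_loss_def power2_eq_square powr_add[symmetric])

text \<open>Covers the index 1, which lies outside the range of the propagation condition: stopping
  at 1 always returns the first observation.\<close>

lemma step_loss_1:
  assumes "1 \<le> K"
  shows "step_loss K v z p 1 y = 0"
proof -
  have "min (khat K v z y) 1 = 1" using khat_in_range[OF assms, of v z y] by simp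
  then show ?thesis by (simp add: step_loss_def adaptive_est_step_def)
qed

lemma measurable_step_loss:
  assumes "k \<in> {1..K}"
  shows "step_loss K v z p k \<in> borel_measurable (Pi\<^sub>M {1..K} (\<lambda>_. borel))"
proof -
  have "(\<lambda>y. adaptive_est_step K v z y k) \<in> borel_measurable (Pi\<^sub>M {1..K} (\<lambda>_. borel))"
    using measurable_adaptive_est_step[OF assms, of "\<lambda>i y. y i"] by simp
  then show ?thesis unfolding step_loss_def using assms by measurable
qed

lemma adaptive_loss_le:
  assumes k: "k \<in> {1..K}" and v: "0 \<le> v k" and "0 < p"
  shows "ennreal (\<bar>inverse (v k) * (y k - adaptive_est K v z y)\<^sup>2\<bar> powr p) \<le>
         ennreal (step_loss K v z p k y) + ennreal_powr (2 * z k) p"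
proof (cases "khat K v z y \<le> k")
  case True
  then have "adaptive_est K v z y = adaptive_est_step K v z y k"
    by (simp add: adaptive_est_def adaptive_est_step_def min_def)
  then show ?thesis
    by (simp add: step_loss_def power2_commute)
next
  case False
  have "khat K v z y \<in> {1..K}" using k by (intro khat_in_range) simp
  \<comment> \<open>The index \<open>khat\<close> was itself accepted, so the pair
    \<open>k < khat\<close> passed its test with threshold \<open>z k\<close>.\<close>
  from le_khat_iff[OF this, of v z y] False k
  have le: "ennreal (test_stat v y k (khat K v z y)) \<le> z k" by auto
  show ?thesis
  proof (cases "z k")
    case (real x)
    have "inverse (v k) * (y k - adaptive_est K v z y)\<^sup>2 / 2 \<le> x"
      using le real by (simp add: test_stat_def adaptive_est_def)
    moreover have "0 \<le> inverse (v k) * (y k - adaptive_est K v z y)\<^sup>2" using v by simp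
    ultimately have "\<bar>inverse (v k) * (y k - adaptive_est K v z y)\<^sup>2\<bar> powr p \<le> (2 * x) powr p"
      using \<open>0 < p\<close> by (intro powr_mono2) auto
    moreover have "2 * z k = ennreal (2 * x)" using real by (simp add: ennreal_mult)
    ultimately have "ennreal (\<bar>inverse (v k) * (y k - adaptive_est K v z y)\<^sup>2\<bar> powr p)
        \<le> ennreal_powr (2 * z k) p"
      using real by (simp add: ennreal_powr_def)
    then show ?thesis by (simp add: add_increasing)
  next
    case top
    then show ?thesis by (simp add: ennreal_powr_def ennreal_mult_eq_top_iff)
  qed
qed

section \<open>The risk bound at \<open>kstar\<close>\<close>

lemma ennreal_le_sqrt:
  assumes "x\<^sup>2 \<le> ennreal a" and "0 \<le> a"
  shows "x \<le> ennreal (sqrt a)"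
  using assms
  by (cases x) (auto simp: power2_eq_square ennreal_mult[symmetric] ennreal_top_mult top_unique
      intro!: real_le_rsqrt)

theorem theorem3p6:
  fixes M :: "'a measure" and \<xi> \<theta>_tilde :: "nat \<Rightarrow> 'a \<Rightarrow> real"
    and \<theta> v :: "nat \<Rightarrow> real" and \<theta>0 r \<alpha> \<Delta> :: real
    and K kstar :: nat and B :: "real mat" and z :: "nat \<Rightarrow> ennreal"
  assumes "prob_space M" and "K \<ge> 1"
    and gaussian: "gaussian_vector M {1..K} \<xi>"
    and zero_mean: "\<And>k. k \<in> {1..K} \<Longrightarrow> prob_space.expectation M (\<xi> k) = 0"
    and covariance: "B = cov_mat M K \<xi>" "invertible_mat B"
    and model: "\<And>k \<omega>. \<theta>_tilde k \<omega> = \<theta> k + \<xi> k \<omega>"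
    and v: "\<And>k. k \<in> {1..K} \<Longrightarrow> v k = prob_space.variance M (\<theta>_tilde k)"
    and v_decreasing: "antimono_on {1..K} v"
    and "r > 0" and "\<alpha> > 0"
    and zK: "z K < \<infinity>"
    and "\<Delta> > 0"
    and Delta_1: "modeling_bias M \<theta>_tilde \<theta> \<theta>0 1 \<le> \<Delta>"
    and kstar: "kstar = Max {k \<in> {1..K}. modeling_bias M \<theta>_tilde \<theta> \<theta>0 k \<le> \<Delta>}"
    \<comment> \<open>under \<open>E\<^sub>0\<close> all \<open>\<theta> k\<close> vanish, so the observations are the \<open>\<xi> k\<close>\<close>
    and propagation: "\<And>k. k \<in> {2..K} \<Longrightarrow>
      (\<integral>\<^sup>+ \<omega>. ennreal (\<bar>inverse (v k) * (adaptive_est_step K v z (\<lambda>i. \<xi> i \<omega>) k - \<xi> k \<omega>)\<^sup>2\<bar> powr r) \<partial>M)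
        \<le> ennreal (\<alpha> * normal_abs_moment (2 * r))"
  shows "(\<integral>\<^sup>+ \<omega>. ennreal (\<bar>inverse (v kstar) *
             (\<theta>_tilde kstar \<omega> - adaptive_est K v z (\<lambda>i. \<theta>_tilde i \<omega>))\<^sup>2\<bar> powr (r / 2)) \<partial>M)
         \<le> ennreal (sqrt (\<alpha> * normal_abs_moment (2 * r) * exp \<Delta>))
            + ennreal_powr (2 * z kstar) (r / 2)"
proof -
  interpret prob_space M by fact
  obtain m :: nat and A where
    law: "\<And>f. f \<in> borel_measurable (Pi\<^sub>M {1..K} (\<lambda>_. borel)) \<Longrightarrow>
      (\<integral>\<^sup>+\<omega>. f (\<lambda>i\<in>{1..K}. \<xi> i \<omega>) \<partial>M) =
      (\<integral>\<^sup>+x. f (\<lambda>i\<in>{1..K}. \<Sum>j<m. A i j * x j) \<partial>Pi\<^sub>M {..<m} (\<lambda>_. std_normal_distribution))"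
    and int: "\<And>i. i \<in> {1..K} \<Longrightarrow> integrable M (\<xi> i)"
    and cov: "\<And>i k. i \<in> {1..K} \<Longrightarrow> k \<in> {1..K} \<Longrightarrow>
      covariance M (\<xi> i) (\<xi> k) = (\<Sum>j<m. A i j * A k j)"
    using gaussian_vector_zero_meanE[OF gaussian zero_mean] by blast
  let ?P = "Pi\<^sub>M {..<m} (\<lambda>_. std_normal_distribution)"
  let ?A = "\<lambda>i. A (Suc i)"
  let ?b = "\<lambda>i. \<theta> (Suc i) - \<theta>0"
  have mean_tilde: "LINT \<omega>|M. \<theta>_tilde i \<omega> = \<theta> i" if "i \<in> {1..K}" for i
    unfolding model using int[OF that] zero_mean[OF that] by (simp add: prob_space)
  have cov_tilde: "covariance M (\<theta>_tilde i) (\<theta>_tilde k) = covariance M (\<xi> i) (\<xi> k)"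
    if "i \<in> {1..K}" "k \<in> {1..K}" for i k
    unfolding covariance_def mean_tilde[OF that(1)] mean_tilde[OF that(2)]
      zero_mean[OF that(1)] zero_mean[OF that(2)]
    by (simp add: model)
  \<comment> \<open>Adding constants leaves covariances unchanged, so one Gram matrix serves both
    the invertibility of \<open>B\<close>, stated for \<open>\<xi>\<close>, and the modeling bias,
    stated for \<open>\<theta>_tilde\<close>.\<close>
  have gram: "cov_mat M k \<xi> = gram m k ?A" "cov_mat M k \<theta>_tilde = gram m k ?A" if "k \<le> K" for k
    using that by (auto simp: cov_mat_def gram_def cov cov_tilde)

  \<comment> \<open>The index \<open>kstar\<close> and the shift that realizes its bias\<close>
  let ?S = "{k \<in> {1..K}. modeling_bias M \<theta>_tilde \<theta> \<theta>0 k \<le> \<Delta>}"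
  have "1 \<in> ?S" using \<open>K \<ge> 1\<close> Delta_1 by simp
  then have "kstar \<in> ?S" unfolding kstar by (intro Max_in) auto
  then have k: "kstar \<in> {1..K}" and bias: "modeling_bias M \<theta>_tilde \<theta> \<theta>0 kstar \<le> \<Delta>"
    by auto
  have "invertible_mat (gram m K ?A)" using covariance gram(1)[of K] by simp
  then obtain h where h: "\<And>i. i < kstar \<Longrightarrow> (\<Sum>l<m. ?A i l * h l) = ?b i"
    and "(\<Sum>l<m. (h l)\<^sup>2) = scalar_prod (vec kstar ?b)
            (the (mat_inverse (gram m kstar ?A)) *\<^sub>v vec kstar ?b)"
    using k by (elim gram_preimage[where k = kstar and b = ?b]) auto
  then have norm_h: "(\<Sum>l<m. (h l)\<^sup>2) \<le> \<Delta>"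
    using bias gram(2)[of kstar] k by (simp add: modeling_bias_def Let_def)

  \<comment> \<open>Measurability of the stopped loss\<close>
  let ?L = "\<lambda>p. step_loss K v z p kstar"
  define F where "F = (\<lambda>x. ennreal (?L (r / 2) (\<lambda>i\<in>{1..K}. \<Sum>j<m. A i j * x j)))"
  have mL [measurable]: "?L p \<in> borel_measurable (Pi\<^sub>M {1..K} (\<lambda>_. borel))" for p
    using k by (rule measurable_step_loss)
  have F [measurable]: "F \<in> borel_measurable (Pi\<^sub>M {..<m} (\<lambda>_. borel))"
    unfolding F_def by measurable
  have L_tilde [measurable]: "(\<lambda>\<omega>. ?L (r / 2) (\<lambda>i. \<theta>_tilde i \<omega>)) \<in> borel_measurable M"
  proof -
    have "\<theta>_tilde i \<in> borel_measurable M" if "i \<in> {1..K}" for i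
      using int[OF that] by (simp add: model[abs_def])
    then have meas: "(\<lambda>\<omega>. \<lambda>i\<in>{1..K}. \<theta>_tilde i \<omega>) \<in> M \<rightarrow>\<^sub>M Pi\<^sub>M {1..K} (\<lambda>_. borel)"
      by (rule measurable_restrict)
    have "?L (r / 2) (\<lambda>i. \<theta>_tilde i \<omega>) = ?L (r / 2) (\<lambda>i\<in>{1..K}. \<theta>_tilde i \<omega>)" for \<omega>
      using k by (intro step_loss_shift[where c = 0]) auto
    with measurable_compose[OF meas mL] show ?thesis by (simp only:)
  qed

  \<comment> \<open>Change of measure for the stopped loss\<close>
  have "(\<integral>\<^sup>+\<omega>. ennreal (?L (r / 2) (\<lambda>i. \<theta>_tilde i \<omega>)) \<partial>M) =
        (\<integral>\<^sup>+\<omega>. ennreal (?L (r / 2) (\<lambda>i\<in>{1..K}. (\<lambda>i\<in>{1..K}. \<xi> i \<omega>) i + \<theta> i)) \<partial>M)"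
    using k by (intro nn_integral_cong arg_cong[where f = ennreal] step_loss_shift[where c = 0])
      (auto simp: model)
  also have "\<dots> = (\<integral>\<^sup>+x. ennreal (?L (r / 2)
      (\<lambda>i\<in>{1..K}. (\<lambda>i\<in>{1..K}. \<Sum>j<m. A i j * x j) i + \<theta> i)) \<partial>?P)"
    by (rule law) measurable
  \<comment> \<open>On the first \<open>kstar\<close> coordinates
    \<open>A x + \<theta> = \<theta>0 + A (x + h)\<close>, because \<open>A h\<close> is the bias
    there. Later coordinates may disagree, but the stopped loss ignores them.\<close>
  also have "\<dots> = (\<integral>\<^sup>+x. F (\<lambda>j\<in>{..<m}. x j + h j) \<partial>?P)"
    unfolding F_def
  proof (intro nn_integral_cong arg_cong[where f = ennreal] step_loss_shift[OF k, where c = \<theta>0])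
    fix x i assume i: "i \<in> {1..kstar}"
    then obtain i' where "i = Suc i'" by (cases i) auto
    then have "(\<Sum>j<m. A i j * h j) = \<theta> i - \<theta>0" using h[of i'] i by simp
    then show "(\<lambda>i\<in>{1..K}. (\<lambda>i\<in>{1..K}. \<Sum>j<m. A i j * x j) i + \<theta> i) i =
      \<theta>0 + (\<lambda>i\<in>{1..K}. \<Sum>j<m. A i j * (\<lambda>j\<in>{..<m}. x j + h j) j) i"
      using i k by (simp add: distrib_left sum.distrib)
  qed
  finally have "(\<integral>\<^sup>+\<omega>. ennreal (?L (r / 2) (\<lambda>i. \<theta>_tilde i \<omega>)) \<partial>M)\<^sup>2 \<le>
      (\<integral>\<^sup>+x. (F x)\<^sup>2 \<partial>?P) * ennreal (exp (\<Sum>l<m. (h l)\<^sup>2))"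
    using nn_integral_PiM_std_normal_shift_le[OF finite_lessThan F, of h] by simp
  \<comment> \<open>Squaring doubles the exponent \<open>r / 2\<close>, and \<open>law\<close> read
    backwards returns to the noise without shift, that is to \<open>E_0\<close>.\<close>
  also have "(\<integral>\<^sup>+x. (F x)\<^sup>2 \<partial>?P) = (\<integral>\<^sup>+\<omega>. ennreal (?L r (\<lambda>i\<in>{1..K}. \<xi> i \<omega>)) \<partial>M)"
    using mL[of r] by (subst law) (simp_all add: F_def ennreal_power step_loss_nonneg step_loss_half_squared)
  also have "\<dots> = (\<integral>\<^sup>+\<omega>. ennreal (?L r (\<lambda>i. \<xi> i \<omega>)) \<partial>M)"
    using k by (intro nn_integral_cong arg_cong[where f = ennreal] step_loss_shift[where c = 0]) auto
  also have "\<dots> \<le> ennreal (\<alpha> * normal_abs_moment (2 * r))"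
  proof (cases "kstar = 1")
    case True
    then show ?thesis using step_loss_1[OF \<open>K \<ge> 1\<close>] by simp
  next
    case False
    then show ?thesis using propagation[of kstar] k by (simp add: step_loss_def)
  qed
  also have "ennreal (exp (\<Sum>l<m. (h l)\<^sup>2)) \<le> ennreal (exp \<Delta>)"
    using norm_h by (simp add: ennreal_leI)
  finally have "(\<integral>\<^sup>+\<omega>. ennreal (?L (r / 2) (\<lambda>i. \<theta>_tilde i \<omega>)) \<partial>M)\<^sup>2 \<le>
      ennreal (\<alpha> * normal_abs_moment (2 * r) * exp \<Delta>)"
    by (simp add: mult_left_mono mult_right_mono ennreal_mult'')
  moreover have "0 \<le> \<alpha> * normal_abs_moment (2 * r) * exp \<Delta>"
    using \<open>\<alpha> > 0\<close> by (simp add: normal_abs_moment_def)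
  ultimately have main: "(\<integral>\<^sup>+\<omega>. ennreal (?L (r / 2) (\<lambda>i. \<theta>_tilde i \<omega>)) \<partial>M) \<le>
      ennreal (sqrt (\<alpha> * normal_abs_moment (2 * r) * exp \<Delta>))"
    by (rule ennreal_le_sqrt)

  \<comment> \<open>From the stopped to the adaptive estimate\<close>
  have "0 \<le> v kstar" using v[OF k] by simp
  then have "(\<integral>\<^sup>+ \<omega>. ennreal (\<bar>inverse (v kstar) *
             (\<theta>_tilde kstar \<omega> - adaptive_est K v z (\<lambda>i. \<theta>_tilde i \<omega>))\<^sup>2\<bar> powr (r / 2)) \<partial>M) \<le>
      (\<integral>\<^sup>+\<omega>. ennreal (?L (r / 2) (\<lambda>i. \<theta>_tilde i \<omega>)) + ennreal_powr (2 * z kstar) (r / 2) \<partial>M)"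
    using \<open>r > 0\<close> by (intro nn_integral_mono adaptive_loss_le k) auto
  also have "\<dots> = (\<integral>\<^sup>+\<omega>. ennreal (?L (r / 2) (\<lambda>i. \<theta>_tilde i \<omega>)) \<partial>M)
      + ennreal_powr (2 * z kstar) (r / 2)"
    by (subst nn_integral_add) (simp_all add: emeasure_space_1)
  finally show ?thesis using main by (meson add_right_mono order_trans)
qed

end
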